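(* Let $a\in\mathbb R$, $c\in\mathbb R\setminus\{0,-1,-2,\dots\}$, and let $z=x+iy$ with $x,y\in\mathbb R\setminus\{0\}$. Assume that $|z|<1$, or that $|z|=1$ and $c-a-1>0$. Then $$\operatorname{Re}\,{}_2F_1(a,1;c;z)=1+\frac ac\,\frac{|z|^2}{x}\,H_4\Big(1,a+1;\frac12,c+1;-\frac{y^2}{4x^2},\frac{|z|^2}{x}\Big),$$ $$\operatorname{Im}\,{}_2F_1(a,1;c;z)=\frac ac\,\frac{y|z|^2}{x^2}\,H_4\Big(2,a+1;\frac32,c+1;-\frac{y^2}{4x^2},\frac{|z|^2}{x}\Big).$$
   Context: With $(\lambda)_n=\lambda(\lambda+1)\cdots(\lambda+n-1)$, $(\lambda)_0=1$, ${}_2F_1(a,b;c;z)=\sum_{n\ge0}\frac{(a)_n(b)_n}{(c)_n}\frac{z^n}{n!}$ is the Gauss hypergeometric function, and the Horn function $H_4$ is defined by $$H_4(\alpha,\beta;\gamma,\delta;s,t)=\sum_{k\ge0}\sum_{n\ge0}\frac{(\alpha)_{2k+n}(\beta)_n}{(\gamma)_k(\delta)_n}\frac{s^k}{k!}\frac{t^n}{n!},\qquad 2\sqrt{|s|}+|t|<1,$$ and outside this convergence domain by analytic continuation; for real arguments $s<0$, $t\in\mathbb R$ this means the (unique) real-analytic continuation from $\{(s,t): s<0,\ 2\sqrt{|s|}+|t|<1\}$ to $(-\infty,0)\times\mathbb R$. *)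

theory Defs
  imports "HOL-Analysis.Analysis"
begin

definition hyp2F1 :: "complex \<Rightarrow> complex \<Rightarrow> complex \<Rightarrow> complex \<Rightarrow> complex" where
  "hyp2F1 a b c z =
     (\<Sum>n. pochhammer a n * pochhammer b n / pochhammer c n * (z ^ n / fact n))"

definition horn_H4_domain :: "(real \<times> real) set" where
  "horn_H4_domain = {(s, t). 2 * sqrt \<bar>s\<bar> + \<bar>t\<bar> < 1}"

definition horn_H4_series ::
    "real \<Rightarrow> real \<Rightarrow> real \<Rightarrow> real \<Rightarrow> real \<Rightarrow> real \<Rightarrow> real" where
  "horn_H4_series \<alpha> \<beta> \<gamma> \<delta> s t =
     (\<Sum>k. \<Sum>n. pochhammer \<alpha> (2 * k + n) * pochhammer \<beta> n /
        (pochhammer \<gamma> k * pochhammer \<delta> n) * (s ^ k / fact k) * (t ^ n / fact n))"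

text \<open>Real analyticity in two variables, meant for open sets: near each point of the set the
  function is the unconditional sum of a double power series centred at that point.\<close>

definition real_analytic2_on ::
    "(real \<Rightarrow> real \<Rightarrow> real) \<Rightarrow> (real \<times> real) set \<Rightarrow> bool" where
  "real_analytic2_on f S \<longleftrightarrow>
     (\<forall>(s0, t0) \<in> S. \<exists>(p :: nat \<Rightarrow> nat \<Rightarrow> real) r. r > 0 \<and>
        (\<forall>s t. \<bar>s - s0\<bar> < r \<longrightarrow> \<bar>t - t0\<bar> < r \<longrightarrow>
           ((\<lambda>(i, j). p i j * (s - s0) ^ i * (t - t0) ^ j) has_sum f s t) UNIV))"

definition is_horn_H4_continuation ::
    "real \<Rightarrow> real \<Rightarrow> real \<Rightarrow> real \<Rightarrow> (real \<Rightarrow> real \<Rightarrow> real) \<Rightarrow> bool" where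
  "is_horn_H4_continuation \<alpha> \<beta> \<gamma> \<delta> F \<longleftrightarrow>
     real_analytic2_on F ({..<0} \<times> UNIV) \<and>
     (\<forall>(s, t) \<in> horn_H4_domain. s < 0 \<longrightarrow> F s t = horn_H4_series \<alpha> \<beta> \<gamma> \<delta> s t)"

text \<open>Continuations are only determined on the half-plane \<open>s < 0\<close>, so the description picks out
  the value at a point rather than the function. Outside the convergence domain the value is
  meaningful only for \<open>s < 0\<close>.\<close>

definition horn_H4 ::
    "real \<Rightarrow> real \<Rightarrow> real \<Rightarrow> real \<Rightarrow> real \<Rightarrow> real \<Rightarrow> real" where
  "horn_H4 \<alpha> \<beta> \<gamma> \<delta> s t =
     (if (s, t) \<in> horn_H4_domain then horn_H4_series \<alpha> \<beta> \<gamma> \<delta> s t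
      else (THE v. \<exists>F. is_horn_H4_continuation \<alpha> \<beta> \<gamma> \<delta> F \<and> v = F s t))"

end

theory Submission
  imports Defs "HOL-Complex_Analysis.Complex_Analysis"
begin

text \<open>
  Write \<open>A\<^sub>n = (a + 1)\<^sub>n / (c + 1)\<^sub>n\<close> and \<open>G(w) = 2F1(a+1,1;c+1;w) = \<Sum>\<^sub>n A\<^sub>n w ^ n\<close>, so that
  \<open>2F1(a,1;c;z) = 1 + (a/c) z G(z)\<close> (\<open>hyp2F1_one_contiguous\<close>). Put \<open>s = - u\<^sup>2 / 4\<close> with \<open>u > 0\<close> and
  \<open>v = 1 / (1 - \<i> u)\<close>. In \<open>H4(1, a+1; 1/2, c+1; s, t)\<close> the coefficient of \<open>A\<^sub>n t ^ n\<close> is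
  \<open>\<Sum>\<^sub>k (2k+n choose n) (\<i> u) ^ (2k)\<close>, the even and hence real part of the negative binomial series
  \<open>\<Sum>\<^sub>j (n+j choose n) (\<i> u) ^ j = v ^ (n + 1)\<close>; the odd part occurs in \<open>H4(2, a+1; 3/2, c+1; s, t)\<close>.
  So in the domain of convergence the two Horn functions are \<open>Re (v G(t v))\<close> and
  \<open>Im (v G(t v)) / u\<close> (\<open>horn_H4_series_eq\<close>). For \<open>u = \<bar>y / x\<bar>\<close> and \<open>t = \<bar>z\<bar>\<^sup>2 / x\<close> the
  number \<open>t v\<close> is \<open>z\<close> or its conjugate, and the asserted formulas are the real and imaginary parts of
  the identity for \<open>2F1(a,1;c;z)\<close>.

  As \<open>(s, t)\<close> may lie outside the domain of convergence, \<open>H4\<close> has to be continued. For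
  \<open>s < 0\<close> and real \<open>t \<noteq> 0\<close> the number \<open>t v\<close> is not real, so it is enough to continue \<open>G\<close> to
  the upper and the lower half-plane. This is possible because \<open>G\<close> satisfies a linear differential
  equation of order one (\<open>hyp2F1_one_continuation\<close>). With the continued function \<open>g\<close> the
  expression \<open>v g(t v)\<close> has local expansions into double power series
  (\<open>double_power_series_composition\<close>), so its real part, and likewise its imaginary part over \<open>u\<close>, is a
  real-analytic continuation; by the identity theorem on lines it is the only one
  (\<open>horn_H4_continuation_unique\<close>). The boundary case \<open>\<bar>z\<bar> = 1\<close> follows by continuity, as
  \<open>c - a > 1\<close> makes the series absolutely convergent on the closed disc.
\<close>

section \<open>The series \<open>2F1(a,1;c)\<close> and its continuation across the unit circle\<close>

lemma pochhammer_nonpos_Ints_nonzero: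
  fixes c :: "'a::field_char_0"
  assumes "c \<notin> \<int>\<^sub>\<le>\<^sub>0"
  shows "pochhammer c n \<noteq> 0" and "c + of_nat n \<noteq> 0"
proof -
  show *: "c + of_nat n \<noteq> 0" for n
    using assms by (metis add.commute minus_of_nat_in_nonpos_Ints add_eq_0_iff)
  show "pochhammer c n \<noteq> 0"
    by (induction n) (auto simp: pochhammer_rec' *)
qed

lemma hyp2F1_one_altdef: "hyp2F1 a 1 c w = (\<Sum>n. pochhammer a n / pochhammer c n * w ^ n)"
  unfolding hyp2F1_def by (simp add: pochhammer_fact[symmetric])

lemma hyp2F1_one_abs_summable:
  fixes a c w :: complex
  assumes "norm w < 1"
  shows "summable (\<lambda>n. norm (pochhammer a n / pochhammer c n * w ^ n))"
proof -
  define q where "q = (1 + norm w) / 2"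
  have q: "norm w < q" "q < 1" using assms by (auto simp: q_def)
  have "(\<lambda>n. norm ((a + of_nat n) / (c + of_nat n) * w)) \<longlonglongrightarrow> norm (1 * w)"
  proof (intro tendsto_intros)
    show "(\<lambda>n. (a + of_nat n) / (c + of_nat n)) \<longlonglongrightarrow> 1"
    proof (rule Lim_transform_eventually)
      have "(\<lambda>n. (a / of_nat n + 1) / (c / of_nat n + 1)) \<longlonglongrightarrow> (0 + 1) / (0 + 1)"
        by (intro tendsto_intros lim_const_over_n) auto
      then show "(\<lambda>n. (a / of_nat n + 1) / (c / of_nat n + 1)) \<longlonglongrightarrow> 1" by simp
      show "\<forall>\<^sub>F n in sequentially. (a / of_nat n + 1) / (c / of_nat n + 1)
              = (a + of_nat n) / (c + of_nat n)"
        using eventually_gt_at_top[of 0]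
      proof eventually_elim
        case (elim n)
        then have "a / of_nat n + 1 = (a + of_nat n) / of_nat n"
          "c / of_nat n + 1 = (c + of_nat n) / of_nat n" by (simp_all add: add_divide_distrib)
        with elim show ?case by simp
      qed
    qed
  qed
  then have "\<forall>\<^sub>F n in sequentially. norm ((a + of_nat n) / (c + of_nat n) * w) < q"
    using q(1) by (intro order_tendstoD) simp_all
  then obtain N where N: "\<And>n. n \<ge> N \<Longrightarrow> norm ((a + of_nat n) / (c + of_nat n) * w) < q"
    by (auto simp: eventually_sequentially)
  show ?thesis
  proof (rule summable_ratio_test[OF q(2)])
    fix n assume "n \<ge> N"
    have "norm (pochhammer a (Suc n) / pochhammer c (Suc n) * w ^ Suc n)
        = norm ((a + of_nat n) / (c + of_nat n) * w)
          * norm (pochhammer a n / pochhammer c n * w ^ n)"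
      by (simp add: pochhammer_rec' norm_mult norm_divide norm_power)
    also have "\<dots> \<le> q * norm (pochhammer a n / pochhammer c n * w ^ n)"
      using N[OF \<open>n \<ge> N\<close>] by (intro mult_right_mono) auto
    finally show "norm (norm (pochhammer a (Suc n) / pochhammer c (Suc n) * w ^ Suc n))
      \<le> q * norm (norm (pochhammer a n / pochhammer c n * w ^ n))" by simp
  qed
qed

lemma hyp2F1_one_sums:
  assumes "norm w < 1"
  shows "(\<lambda>n. pochhammer a n / pochhammer c n * w ^ n) sums hyp2F1 a 1 c w"
  unfolding hyp2F1_one_altdef
  by (rule summable_sums[OF summable_norm_cancel[OF hyp2F1_one_abs_summable[OF assms]]])

text \<open>Since \<open>(a)\<^sub>n\<^sub>+\<^sub>1 = a (a + 1)\<^sub>n\<close>, dropping the constant term of \<open>2F1(a,1;c;w)\<close> leaves a multiple of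
  \<open>w * 2F1(a+1,1;c+1;w)\<close>.\<close>

lemma hyp2F1_one_contiguous:
  assumes "(\<lambda>n. pochhammer a n / pochhammer c n * w ^ n) sums S"
    and "(\<lambda>n. pochhammer (a + 1) n / pochhammer (c + 1) n * w ^ n) sums (T::complex)"
  shows "S = 1 + a / c * w * T"
proof -
  have "(\<lambda>n. a / c * w * (pochhammer (a + 1) n / pochhammer (c + 1) n * w ^ n)) sums (a / c * w * T)"
    by (intro sums_mult assms)
  then have "(\<lambda>n. pochhammer a (Suc n) / pochhammer c (Suc n) * w ^ Suc n) sums (a / c * w * T)"
    by (simp add: pochhammer_rec algebra_simps)
  from sums_Suc[OF this] have "(\<lambda>n. pochhammer a n / pochhammer c n * w ^ n) sums (1 + a / c * w * T)"
    by (simp add: add.commute)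
  with assms(1) show ?thesis by (rule sums_unique2)
qed

lemma hyp2F1_one_holomorphic: "hyp2F1 a 1 c holomorphic_on ball 0 1"
  by (rule power_series_holomorphic[of _ _ "\<lambda>n. pochhammer a n / pochhammer c n"])
     (use hyp2F1_one_sums in auto)

text \<open>The coefficients \<open>A\<^sub>n = (a)\<^sub>n / (c)\<^sub>n\<close> satisfy the two-term recurrence \<open>(c + n) A\<^sub>n\<^sub>+\<^sub>1 = (a + n) A\<^sub>n\<close>;
  multiplied by \<open>w ^ (n + 1)\<close> and summed, it is a differential equation of order one. Having order
  one instead of two is what the numerator parameter \<open>1\<close> buys.\<close>

lemma hyp2F1_one_differential_equation:
  assumes c: "c \<notin> \<int>\<^sub>\<le>\<^sub>0" and w: "norm w < 1"
  obtains D where "(hyp2F1 a 1 c has_field_derivative D) (at w)"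
    and "w * (1 - w) * D = (c - 1) * (1 - hyp2F1 a 1 c w) + a * w * hyp2F1 a 1 c w"
proof -
  let ?A = "\<lambda>n. pochhammer a n / pochhammer c n"
  define G where "G = hyp2F1 a 1 c w"
  have sm: "summable (\<lambda>n. ?A n * x ^ n)" if "norm x < 1" for x
    by (rule summable_norm_cancel[OF hyp2F1_one_abs_summable[OF that]])
  define D where "D = (\<Sum>n. diffs ?A n * w ^ n)"
  have G: "(\<lambda>n. ?A n * w ^ n) sums G" unfolding G_def by (rule hyp2F1_one_sums[OF w])
  have DG: "((\<lambda>w. \<Sum>n. ?A n * w ^ n) has_field_derivative D) (at w)"
    unfolding D_def by (rule termdiffs_strong'[where K = 1]) (use sm w in auto)
  have D: "(\<lambda>n. diffs ?A n * w ^ n) sums D"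
    unfolding D_def by (intro summable_sums termdiff_converges[OF w] sm)
  have 1: "(\<lambda>n. of_nat (Suc n) * ?A (Suc n) * w ^ Suc n) sums (w * D)"
    using sums_mult[OF D, of w] by (simp add: diffs_def algebra_simps)
  have 2: "(\<lambda>n. of_nat n * ?A n * w ^ n) sums (w * D)"
    using sums_Suc[OF 1] by simp
  have 3: "(\<lambda>n. ?A (Suc n) * w ^ Suc n) sums (G - 1)"
    using G by (subst sums_Suc_iff) simp
  have "(\<lambda>n. of_nat (Suc n) * ?A (Suc n) * w ^ Suc n + (c - 1) * (?A (Suc n) * w ^ Suc n))
          sums (w * D + (c - 1) * (G - 1))"
    by (intro sums_add sums_mult 1 3)
  moreover have "(\<lambda>n. w * (of_nat n * ?A n * w ^ n + a * (?A n * w ^ n))) sums (w * (w * D + a * G))"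
    by (intro sums_add sums_mult 2 G)
  moreover have "of_nat (Suc n) * ?A (Suc n) * w ^ Suc n + (c - 1) * (?A (Suc n) * w ^ Suc n)
      = w * (of_nat n * ?A n * w ^ n + a * (?A n * w ^ n))" for n
  proof -
    have "(c + of_nat n) * ?A (Suc n) = (a + of_nat n) * ?A n"
      using pochhammer_nonpos_Ints_nonzero[OF c, of n] by (simp add: pochhammer_rec')
    moreover have "of_nat (Suc n) * A1 * w ^ Suc n + (c - 1) * (A1 * w ^ Suc n)
        = (c + of_nat n) * A1 * w ^ Suc n" for A1
      by (simp add: ring_distribs)
    moreover have "w * (of_nat n * A0 * w ^ n + a * (A0 * w ^ n)) = (a + of_nat n) * A0 * w ^ Suc n" for A0
      by (simp add: ring_distribs mult_ac)
    ultimately show ?thesis by metis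
  qed
  ultimately have "w * D + (c - 1) * (G - 1) = w * (w * D + a * G)"
    by (simp only:) (rule sums_unique2)
  then have "w * (1 - w) * D = (c - 1) * (1 - G) + a * w * G"
    by (simp add: algebra_simps)
  with that[of D] DG show thesis by (simp add: hyp2F1_one_altdef[abs_def] G_def)
qed

text \<open>A linear equation of order one is solved by an integrating factor \<open>\<mu>\<close> and a primitive: off the real
  axis \<open>\<mu> w = w powr (c - 1) * (1 - w) powr (a + 1 - c)\<close> is holomorphic, and
  \<open>(\<mu> * 2F1)' = (c - 1) \<mu> / (w (1 - w))\<close> has a primitive on every open convex set there. The right-hand side no
  longer refers to the series, so the solution exists beyond the unit disc.\<close>

lemma hyp2F1_one_continuation_convex:
  assumes c: "c \<notin> \<int>\<^sub>\<le>\<^sub>0" and S: "convex S" "open S" "\<And>w. w \<in> S \<Longrightarrow> Im w \<noteq> 0"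
  obtains g where "g holomorphic_on S" "\<And>w. w \<in> S \<Longrightarrow> norm w < 1 \<Longrightarrow> g w = hyp2F1 a 1 c w"
proof -
  define \<mu> where "\<mu> w = exp ((c - 1) * Ln w + (a + 1 - c) * Ln (1 - w))" for w
  have nz: "w \<notin> \<real>\<^sub>\<le>\<^sub>0" "1 - w \<notin> \<real>\<^sub>\<le>\<^sub>0" "w \<noteq> 0" "1 - w \<noteq> 0" if "w \<in> S" for w
    using S(3)[OF that] by (auto simp: complex_nonpos_Reals_iff complex_eq_iff)
  have \<mu>: "(\<mu> has_field_derivative \<mu> w * ((c - 1) / w - (a + 1 - c) / (1 - w))) (at w)"
    if "w \<in> S" for w
    unfolding \<mu>_def
    by (auto intro!: derivative_eq_intros simp: nz[OF that] divide_inverse algebra_simps)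
  have \<mu>0: "\<mu> w \<noteq> 0" for w by (simp add: \<mu>_def)
  have hol: "\<mu> holomorphic_on S" using \<mu> S(2)
    by (auto simp: holomorphic_on_open)
  have "(\<lambda>w. (c - 1) * \<mu> w / (w * (1 - w))) holomorphic_on S"
    by (intro holomorphic_intros hol) (use nz in force)
  from holomorphic_convex_primitive'[OF S(1,2) this] obtain H where
    "\<And>w. w \<in> S \<Longrightarrow> (H has_field_derivative (c - 1) * \<mu> w / (w * (1 - w))) (at w within S)"
    by blast
  then have H: "(H has_field_derivative (c - 1) * \<mu> w / (w * (1 - w))) (at w)" if "w \<in> S" for w
    using S(2) that by (metis at_within_open)
  have "\<exists>K. \<forall>w\<in>S \<inter> ball 0 1. \<mu> w * hyp2F1 a 1 c w - H w = K"
  proof (rule has_field_derivative_zero_constant)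
    show "convex (S \<inter> ball 0 1)" by (intro convex_Int S(1) convex_ball)
    fix w assume w: "w \<in> S \<inter> ball 0 1"
    then have w': "w \<in> S" "norm w < 1" by auto
    obtain D where D: "(hyp2F1 a 1 c has_field_derivative D) (at w)"
      and e: "w * (1 - w) * D = (c - 1) * (1 - hyp2F1 a 1 c w) + a * w * hyp2F1 a 1 c w"
      using hyp2F1_one_differential_equation[OF c w'(2)] by blast
    have "D = ((c - 1) * (1 - hyp2F1 a 1 c w) + a * w * hyp2F1 a 1 c w) / (w * (1 - w))"
      using e nz[OF w'(1)] by (simp add: eq_divide_eq mult_ac)
    then have "((c - 1) / w - (a + 1 - c) / (1 - w)) * hyp2F1 a 1 c w + D - (c - 1) / (w * (1 - w)) = 0"
      using nz[OF w'(1)] by (simp add: divide_simps) (simp add: algebra_simps)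
    then have "\<mu> w * (((c - 1) / w - (a + 1 - c) / (1 - w)) * hyp2F1 a 1 c w + D - (c - 1) / (w * (1 - w))) = 0"
      by simp
    then have "\<mu> w * ((c - 1) / w - (a + 1 - c) / (1 - w)) * hyp2F1 a 1 c w + D * \<mu> w
          - (c - 1) * \<mu> w / (w * (1 - w)) = 0"
      by (simp add: ring_distribs mult_ac)
    then have "((\<lambda>w. \<mu> w * hyp2F1 a 1 c w - H w) has_field_derivative 0) (at w)"
      using DERIV_diff[OF DERIV_mult[OF \<mu>[OF w'(1)] D] H[OF w'(1)]] by simp
    then show "((\<lambda>w. \<mu> w * hyp2F1 a 1 c w - H w) has_field_derivative 0) (at w within S \<inter> ball 0 1)"
      by (rule has_field_derivative_at_within)
  qed
  then obtain K where K: "\<And>w. w \<in> S \<inter> ball 0 1 \<Longrightarrow> \<mu> w * hyp2F1 a 1 c w - H w = K" by blast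
  have "H holomorphic_on S" using H S(2) by (auto simp: holomorphic_on_open)
  then have "(\<lambda>w. (H w + K) / \<mu> w) holomorphic_on S"
    by (intro holomorphic_intros hol) (auto simp: \<mu>0)
  moreover have "(H w + K) / \<mu> w = hyp2F1 a 1 c w" if "w \<in> S" "norm w < 1" for w
    using K[of w] that \<mu>0[of w] by (auto simp: field_simps)
  ultimately show thesis using that by blast
qed

text \<open>The cut lies on the real axis outside the disc. The two half-planes are disjoint, and on the overlap
  with the disc each of the two solutions is the series itself, so the three pieces fit together.\<close>

lemma hyp2F1_one_continuation:
  assumes c: "c \<notin> \<int>\<^sub>\<le>\<^sub>0"
  obtains g where "g holomorphic_on (ball 0 1 \<union> {w. Im w \<noteq> 0})"
    "\<And>w. norm w < 1 \<Longrightarrow> g w = hyp2F1 a 1 c w"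
proof -
  have op: "open {w. Im w > 0}" "open {w. Im w < 0}" and cv: "convex {w. Im w > 0}" "convex {w. Im w < 0}"
    by (auto simp: open_halfspace_Im_gt open_halfspace_Im_lt convex_halfspace_Im_gt convex_halfspace_Im_lt)
  obtain g where g: "g holomorphic_on {w. Im w > 0}"
    "\<And>w. Im w > 0 \<Longrightarrow> norm w < 1 \<Longrightarrow> g w = hyp2F1 a 1 c w"
    by (rule hyp2F1_one_continuation_convex[OF c cv(1) op(1), of a]) auto
  obtain h where h: "h holomorphic_on {w. Im w < 0}"
    "\<And>w. Im w < 0 \<Longrightarrow> norm w < 1 \<Longrightarrow> h w = hyp2F1 a 1 c w"
    by (rule hyp2F1_one_continuation_convex[OF c cv(2) op(2), of a]) auto
  define k where "k = (\<lambda>w. if w \<in> {w. Im w > 0} then g w else h w)"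
  have k: "k holomorphic_on ({w. Im w > 0} \<union> {w. Im w < 0})"
    unfolding k_def by (intro holomorphic_on_If_Un g h op) auto
  define f where "f = (\<lambda>w. if w \<in> ball 0 1 then hyp2F1 a 1 c w else k w)"
  have "f holomorphic_on (ball 0 1 \<union> ({w. Im w > 0} \<union> {w. Im w < 0}))"
    unfolding f_def by (intro holomorphic_on_If_Un k hyp2F1_one_holomorphic open_Un op open_ball)
      (auto simp: k_def g h)
  moreover have "{w. Im w > 0} \<union> {w. Im w < 0} = {w. Im w \<noteq> 0}" by auto
  ultimately show thesis by (intro that[of f]) (auto simp: f_def)
qed

text \<open>Raabe's test: the ratio of successive terms is \<open>(a + n) / (c + n) = 1 - (c - a) / n + o(1 / n)\<close>. If \<open>a\<close>
  is a nonpositive integer, the series terminates.\<close>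

lemma pochhammer_quotient_abs_summable:
  fixes a c :: real
  assumes c: "c \<notin> \<int>\<^sub>\<le>\<^sub>0" and ac: "c - a - 1 > 0"
  shows "summable (\<lambda>n. \<bar>pochhammer a n / pochhammer c n\<bar>)"
proof (cases "a \<in> \<int>\<^sub>\<le>\<^sub>0")
  case True
  then obtain m where m: "a = - of_nat m" by (auto elim: nonpos_Ints_cases')
  have "pochhammer a n = 0" if "n \<notin> {..m}" for n
    using that m by (auto simp: pochhammer_eq_0_iff)
  then show ?thesis by (intro summable_finite[of "{..m}"]) auto
next
  case False
  note nza = pochhammer_nonpos_Ints_nonzero[OF False]
  note nzc = pochhammer_nonpos_Ints_nonzero[OF c]
  let ?f = "\<lambda>n. \<bar>pochhammer a n / pochhammer c n\<bar>"
  show ?thesis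
  proof (rule raabes_test_convergence)
    show "\<forall>\<^sub>F n in sequentially. ?f n > 0" by (auto simp: nza nzc)
    have "(\<lambda>n. of_nat n * (?f n / ?f (Suc n) - 1)) \<longlonglongrightarrow> c - a"
    proof (rule Lim_transform_eventually)
      have "(\<lambda>n. (c - a) / (a / of_nat n + 1)) \<longlonglongrightarrow> (c - a) / (0 + 1)"
        by (intro tendsto_intros lim_const_over_n) auto
      then show "(\<lambda>n. (c - a) / (a / real n + 1)) \<longlonglongrightarrow> c - a" by simp
      obtain N :: nat where N: "real N > \<bar>a\<bar> + \<bar>c\<bar>" using reals_Archimedean2 by blast
      show "\<forall>\<^sub>F n in sequentially. (c - a) / (a / real n + 1) = of_nat n * (?f n / ?f (Suc n) - 1)"
        using eventually_ge_at_top[of N]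
      proof eventually_elim
        case (elim n)
        then have n: "real n > \<bar>a\<bar> + \<bar>c\<bar>" using N by linarith
        then have p: "a + real n > 0" "c + real n > 0" "real n > 0" by linarith+
        have e0: "?f n / ?f (Suc n) = (c + real n) / (a + real n)"
          using p nza(1)[of n] nzc(1)[of n] by (simp add: pochhammer_rec' abs_mult)
        have e: "?f n / ?f (Suc n) - 1 = (c - a) / (a + real n)"
          unfolding e0 using p by (simp add: divide_simps)
        have "of_nat n * (?f n / ?f (Suc n) - 1) = real n * (c - a) / (a + real n)"
          by (simp only: e times_divide_eq_right)
        also have "\<dots> = (c - a) / (a / real n + 1)"
          using p by (simp add: divide_simps)
        finally show ?case by simp
      qed
    qed
    then have "(\<lambda>n. ereal (of_nat n * (?f n / ?f (Suc n) - 1))) \<longlonglongrightarrow> ereal (c - a)"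
      by simp
    then have "liminf (\<lambda>n. ereal (of_nat n * (?f n / ?f (Suc n) - 1))) = ereal (c - a)"
      by (intro lim_imp_Liminf) auto
    then show "liminf (\<lambda>n. ereal (of_nat n * (?f n / ?f (Suc n) - 1))) > 1"
      using ac by simp
  qed
qed

lemma hyp2F1_one_continuous_cball:
  fixes a c :: real
  assumes c: "c \<notin> \<int>\<^sub>\<le>\<^sub>0" and ac: "c - a - 1 > 0"
  shows "continuous_on (cball 0 1) (hyp2F1 (of_real a) 1 (of_real c))"
proof -
  have "uniform_limit (cball 0 1)
      (\<lambda>n w. \<Sum>i<n. pochhammer (of_real a) i / pochhammer (of_real c) i * w ^ i)
      (hyp2F1 (of_real a) 1 (of_real c)) sequentially"
    unfolding hyp2F1_one_altdef[abs_def]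
  proof (rule Weierstrass_m_test[OF _ pochhammer_quotient_abs_summable[OF c ac]])
    fix n and w :: complex assume "w \<in> cball 0 1"
    then have "norm w ^ n \<le> 1" by (simp add: power_le_one)
    then have "\<bar>pochhammer a n / pochhammer c n\<bar> * norm w ^ n \<le> \<bar>pochhammer a n / pochhammer c n\<bar>"
      by (intro mult_left_le) auto
    then show "norm (pochhammer (of_real a) n / pochhammer (of_real c) n * w ^ n)
        \<le> \<bar>pochhammer a n / pochhammer c n\<bar>"
      by (simp only: pochhammer_of_real norm_mult norm_divide norm_power norm_of_real abs_divide)
  qed
  then show ?thesis
    by (rule uniform_limit_theorem[rotated])
       (auto intro!: always_eventually continuous_intros
             simp: pochhammer_of_real pochhammer_nonpos_Ints_nonzero(1)[OF c])
qed

text \<open>On the unit circle the series converges uniformly up to the boundary, so the identity valid in the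
  disc passes to the radial limit; the continuation \<open>g\<close> is continuous there since \<open>z\<close> is not real.\<close>

lemma hyp2F1_one_eq_continuation:
  fixes a c :: real
  assumes c: "c \<notin> \<int>\<^sub>\<le>\<^sub>0"
    and g: "g holomorphic_on (ball 0 1 \<union> {w. Im w \<noteq> 0})"
    "\<And>w. norm w < 1 \<Longrightarrow> g w = hyp2F1 (of_real (a + 1)) 1 (of_real (c + 1)) w"
    and z: "Im z \<noteq> 0" "norm z < 1 \<or> norm z = 1 \<and> c - a - 1 > 0"
  shows "hyp2F1 (of_real a) 1 (of_real c) z = 1 + of_real (a / c) * (z * g z)"
proof -
  have in_ball: "hyp2F1 (of_real a) 1 (of_real c) w = 1 + of_real (a / c) * (w * g w)"
    if "norm w < 1" for w
    using hyp2F1_one_contiguous[OF hyp2F1_one_sums[OF that] hyp2F1_one_sums[OF that], of "of_real a" "of_real c"]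
      g(2)[OF that] by simp
  show ?thesis
  proof (cases "norm z < 1")
    case False
    with z have z1: "norm z = 1" and ac: "c - a - 1 > 0" by auto
    define r where "r n = of_real (1 - 1 / real (Suc n)) * z" for n
    have "r \<longlonglongrightarrow> of_real (1 - 0) * z" unfolding r_def
      by (intro tendsto_intros LIMSEQ_Suc[OF lim_1_over_n])
    then have r: "r \<longlonglongrightarrow> z" by simp
    have r1: "norm (r n) < 1" for n
      by (simp add: r_def norm_mult z1 del: of_real_diff of_real_divide)
    have "(\<lambda>n. hyp2F1 (of_real a) 1 (of_real c) (r n)) \<longlonglongrightarrow> hyp2F1 (of_real a) 1 (of_real c) z"
      by (rule continuous_on_tendsto_compose[OF hyp2F1_one_continuous_cball[OF c ac] r])
         (use z1 r1 in \<open>auto intro!: always_eventually less_imp_le\<close>)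
    moreover have "(\<lambda>n. hyp2F1 (of_real a) 1 (of_real c) (r n)) \<longlonglongrightarrow> 1 + of_real (a / c) * (z * g z)"
      unfolding in_ball[OF r1]
      by (intro tendsto_intros r continuous_on_tendsto_compose[OF holomorphic_on_imp_continuous_on[OF g(1)] r])
         (use z r1 in auto)
    ultimately show ?thesis by (rule LIMSEQ_unique)
  qed (use in_ball in auto)
qed

section \<open>Real analyticity of real parts of compositions\<close>

lemma has_sum_geometric:
  fixes x :: real assumes "0 \<le> x" "x < 1"
  shows "((\<lambda>n. x ^ n) has_sum (1 / (1 - x))) UNIV"
  using assms by (intro norm_summable_imp_has_sum geometric_sums)
    (auto simp: summable_geometric abs_mult power_abs)

lemma double_geometric_summable:
  fixes x y :: real
  assumes "0 \<le> x" "x < 1" "0 \<le> y" "y < 1"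
  shows "(\<lambda>(i, j). x ^ i * y ^ j) summable_on (UNIV :: (nat \<times> nat) set)"
proof -
  have "(\<lambda>(i, j). x ^ i * y ^ j) summable_on Sigma (UNIV :: nat set) (\<lambda>_. UNIV :: nat set)"
  proof (rule summable_on_SigmaI)
    show "((\<lambda>j. case (i, j) of (i, j) \<Rightarrow> x ^ i * y ^ j) has_sum (x ^ i * (1 / (1 - y)))) UNIV" for i :: nat
      using has_sum_cmult_right[OF has_sum_geometric[OF assms(3,4)]] by simp
    show "(\<lambda>i. x ^ i * (1 / (1 - y))) summable_on (UNIV :: nat set)"
      by (rule summable_on_cmult_left) (use has_sum_geometric[OF assms(1,2)] in \<open>auto simp: summable_on_def\<close>)
  qed (use assms in auto)
  then show ?thesis by simp
qed

text \<open>Expand the coefficients \<open>c\<^sub>j\<close> of a power series in \<open>t\<close> in powers of \<open>s\<close>. The Cauchy estimate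
  \<open>M / (R' ^ j * r ^ i)\<close> for the resulting double coefficients is geometric in both indices, which
  gives the unconditional convergence.\<close>

lemma double_power_series:
  fixes f :: "complex \<Rightarrow> complex \<Rightarrow> complex" and c :: "nat \<Rightarrow> complex \<Rightarrow> complex"
  assumes R: "0 < r" "r < R" "0 < R'"
    and hol: "\<And>j. c j holomorphic_on ball s0 R"
    and bound: "\<And>j s. s \<in> ball s0 R \<Longrightarrow> norm (c j s) \<le> M / R' ^ j"
    and sums: "\<And>s t. s \<in> ball s0 R \<Longrightarrow> t \<in> ball t0 R' \<Longrightarrow> (\<lambda>j. c j s * (t - t0) ^ j) sums f s t"
  obtains p where "\<And>s t. norm (s - s0) < r \<Longrightarrow> norm (t - t0) < R' \<Longrightarrow>
      ((\<lambda>(i, j). p i j * (s - s0) ^ i * (t - t0) ^ j) has_sum f s t) UNIV"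
proof -
  define p where "p i j = (deriv ^^ i) (c j) s0 / fact i" for i j
  have M: "M \<ge> 0" using bound[of s0 0] R order_trans[OF norm_ge_zero] by fastforce
  have p: "norm (p i j) \<le> M / R' ^ j / r ^ i" for i j
  proof -
    have "norm ((deriv ^^ i) (c j) s0) \<le> fact i * (M / R' ^ j) / r ^ i"
    proof (rule Cauchy_inequality)
      show "c j holomorphic_on ball s0 r" "continuous_on (cball s0 r) (c j)"
        using R by (auto intro!: holomorphic_on_imp_continuous_on intro: holomorphic_on_subset[OF hol])
      show "norm (c j x) \<le> M / R' ^ j" if "norm (s0 - x) = r" for x
        using that R by (intro bound) (auto simp: dist_norm)
    qed (use R in auto)
    then show ?thesis by (simp add: p_def norm_divide field_simps)
  qed
  show thesis
  proof (rule that)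
    fix s t assume s: "norm (s - s0) < r" and t: "norm (t - t0) < R'"
    define x where "x = norm (t - t0) / R'"
    define y where "y = norm (s - s0) / r"
    have xy: "0 \<le> x" "x < 1" "0 \<le> y" "y < 1" using s t R by (auto simp: x_def y_def)
    let ?F = "\<lambda>(j, i). p i j * (s - s0) ^ i * (t - t0) ^ j"
    have s': "s \<in> ball s0 R" and t': "t \<in> ball t0 R'" using s t R by (auto simp: dist_norm norm_minus_commute)
    have bnd: "norm (p i j * (s - s0) ^ i * (t - t0) ^ j) \<le> M * (x ^ j * y ^ i)" for i j
    proof -
      have "norm (p i j * (s - s0) ^ i * (t - t0) ^ j)
          \<le> M / R' ^ j / r ^ i * norm (s - s0) ^ i * norm (t - t0) ^ j"
        unfolding norm_mult norm_power by (intro mult_right_mono p) auto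
      also have "\<dots> = M * (x ^ j * y ^ i)"
        by (simp add: x_def y_def power_divide)
      finally show ?thesis .
    qed
    have "?F summable_on (UNIV :: (nat \<times> nat) set)"
    proof (rule Infinite_Sum.abs_summable_summable, rule Infinite_Sum.abs_summable_on_comparison_test')
      show "(\<lambda>(j, i). M * (x ^ j * y ^ i)) summable_on (UNIV :: (nat \<times> nat) set)"
        using summable_on_cmult_right[OF double_geometric_summable[OF xy]]
        by (simp add: case_prod_unfold)
    qed (use bnd in auto)
    moreover have "((\<lambda>i. p i j * (s - s0) ^ i * (t - t0) ^ j) has_sum (c j s * (t - t0) ^ j)) UNIV" for j
    proof (rule has_sum_cmult_left, rule norm_summable_imp_has_sum)
      show "(\<lambda>i. p i j * (s - s0) ^ i) sums c j s"
        unfolding p_def by (rule holomorphic_power_series[OF hol s'])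
      have "summable (\<lambda>i. M / R' ^ j * y ^ i)"
        using xy by (intro summable_mult summable_geometric) auto
      then show "summable (\<lambda>i. norm (p i j * (s - s0) ^ i))"
      proof (rule summable_comparison_test'[where N = 0])
        fix i :: nat
        have "norm (p i j * (s - s0) ^ i) \<le> M / R' ^ j / r ^ i * norm (s - s0) ^ i"
          unfolding norm_mult norm_power by (intro mult_right_mono p) auto
        then show "norm (norm (p i j * (s - s0) ^ i)) \<le> M / R' ^ j * y ^ i"
          by (simp add: y_def power_divide)
      qed
    qed
    moreover have "((\<lambda>j. c j s * (t - t0) ^ j) has_sum f s t) UNIV"
    proof (rule norm_summable_imp_has_sum[OF _ sums[OF s' t']])
      have "summable (\<lambda>j. M * x ^ j)" using xy by (intro summable_mult summable_geometric) auto
      then show "summable (\<lambda>j. norm (c j s * (t - t0) ^ j))"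
      proof (rule summable_comparison_test'[where N = 0])
        fix j :: nat
        have "norm (c j s * (t - t0) ^ j) \<le> M / R' ^ j * norm (t - t0) ^ j"
          unfolding norm_mult norm_power by (intro mult_right_mono bound s') auto
        then show "norm (norm (c j s * (t - t0) ^ j)) \<le> M * x ^ j"
          by (simp add: x_def power_divide)
      qed
    qed
    ultimately have "(?F has_sum f s t) (Sigma UNIV (\<lambda>_. UNIV))"
      by (intro has_sum_SigmaI[where g = "\<lambda>j. c j s * (t - t0) ^ j"]) auto
    then show "((\<lambda>(i, j). p i j * (s - s0) ^ i * (t - t0) ^ j) has_sum f s t) UNIV"
      by (subst (asm) has_sum_swap) simp
  qed
qed

text \<open>The Taylor coefficients in \<open>t\<close> of \<open>\<kappa> s * g (t * v s)\<close> are explicit, namely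
  \<open>\<kappa> s * v s ^ j * g\<^sup>(\<^sup>j\<^sup>) (t0 * v s) / j!\<close>. This makes their holomorphy in \<open>s\<close> evident; the bound for them
  is the Cauchy estimate in \<open>t\<close> on a compact bidisc.\<close>

lemma double_power_series_composition:
  fixes g v \<kappa> :: "complex \<Rightarrow> complex"
  assumes g: "g holomorphic_on \<Omega>" "open \<Omega>" and v: "v holomorphic_on D" "\<kappa> holomorphic_on D" "open D"
    and s0: "s0 \<in> D" "t0 * v s0 \<in> \<Omega>"
  obtains p r where "r > 0" "\<And>s t. norm (s - s0) < r \<Longrightarrow> norm (t - t0) < r \<Longrightarrow>
      ((\<lambda>(i, j). p i j * (s - s0) ^ i * (t - t0) ^ j) has_sum \<kappa> s * g (t * v s)) UNIV"
proof -
  define U where "U = (D \<times> UNIV) \<inter> (\<lambda>(s, t). t * v s) -` \<Omega>"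
  have contD: "continuous_on (D \<times> UNIV) (\<lambda>x. v (fst x))" "continuous_on (D \<times> UNIV) (\<lambda>x. \<kappa> (fst x))"
    by (intro continuous_intros continuous_on_compose2[OF holomorphic_on_imp_continuous_on[OF v(1)]]
        continuous_on_compose2[OF holomorphic_on_imp_continuous_on[OF v(2)]]; auto)+
  have "open U" unfolding U_def
    by (intro continuous_open_preimage open_Times v open_UNIV g)
       (auto simp: case_prod_unfold intro!: continuous_intros contD)
  moreover have "(s0, t0) \<in> U" using s0 by (auto simp: U_def)
  ultimately obtain A B where AB: "open A" "open B" "(s0, t0) \<in> A \<times> B" "A \<times> B \<subseteq> U"
    using open_prod_elim by blast
  then obtain e1 e2 where e: "e1 > 0" "cball s0 e1 \<subseteq> A" "e2 > 0" "cball t0 e2 \<subseteq> B"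
    by (meson mem_Sigma_iff open_contains_cball)
  define \<delta> where "\<delta> = min e1 e2"
  have \<delta>: "\<delta> > 0" using e by (simp add: \<delta>_def)
  have "cball s0 \<delta> \<subseteq> A" "cball t0 \<delta> \<subseteq> B" using e by (auto simp: \<delta>_def)
  with AB(4) have sub: "cball s0 \<delta> \<times> cball t0 \<delta> \<subseteq> U" by blast
  have inD: "s \<in> D" if "s \<in> cball s0 \<delta>" for s
    using subsetD[OF sub, of "(s, t0)"] that \<delta> by (simp add: U_def)
  have in\<Omega>: "t * v s \<in> \<Omega>" if "s \<in> cball s0 \<delta>" "t \<in> cball t0 \<delta>" for s t
    using subsetD[OF sub, of "(s, t)"] that by (simp add: U_def)
  define f where "f s t = \<kappa> s * g (t * v s)" for s t
  have "continuous_on (cball s0 \<delta> \<times> cball t0 \<delta>) (\<lambda>x. \<kappa> (fst x) * g (snd x * v (fst x)))"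
    by (intro continuous_intros continuous_on_compose2[OF holomorphic_on_imp_continuous_on[OF g(1)]]
        continuous_on_subset[OF contD(1)] continuous_on_subset[OF contD(2)])
       (auto intro: inD in\<Omega>)
  then have "bounded ((\<lambda>x. f (fst x) (snd x)) ` (cball s0 \<delta> \<times> cball t0 \<delta>))"
    unfolding f_def by (intro compact_imp_bounded compact_continuous_image compact_Times compact_cball)
  then obtain M where M0: "\<forall>y \<in> (\<lambda>x. f (fst x) (snd x)) ` (cball s0 \<delta> \<times> cball t0 \<delta>). norm y \<le> M"
    unfolding bounded_iff by blast
  have M: "norm (f s t) \<le> M" if "s \<in> cball s0 \<delta>" "t \<in> cball t0 \<delta>" for s t
    using M0[unfolded ball_simps, rule_format, of "(s, t)"] that by simp
  \<comment> \<open>the coefficients in \<open>t\<close>, written so that they are visibly holomorphic in \<open>s\<close>\<close>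
  define c where "c j s = \<kappa> s * (v s ^ j * (deriv ^^ j) g (t0 * v s)) / fact j" for j s
  have holt: "(\<lambda>t. g (t * v s)) holomorphic_on ball t0 \<delta>" if "s \<in> cball s0 \<delta>" for s
    by (rule holomorphic_on_compose_gen[OF _ g(1), unfolded o_def])
       (auto intro!: holomorphic_intros in\<Omega> that)
  have cderiv: "c j s = (deriv ^^ j) (f s) t0 / fact j" if "s \<in> cball s0 \<delta>" for j s
  proof -
    have "(deriv ^^ j) (f s) t0 = \<kappa> s * (deriv ^^ j) (\<lambda>t. g (v s * t)) t0"
      unfolding f_def using higher_deriv_cmult[OF holt[OF that], of t0 j "\<kappa> s"] \<delta> by (simp add: mult.commute)
    also have "(deriv ^^ j) (\<lambda>t. g (v s * t)) t0 = v s ^ j * (deriv ^^ j) g (v s * t0)"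
      by (rule higher_deriv_compose_linear[OF g(1) open_ball[of t0 \<delta>] g(2)])
         (use \<delta> in\<Omega>[OF that] in \<open>auto simp: mult.commute\<close>)
    finally show ?thesis by (simp add: c_def mult_ac)
  qed
  have holf: "f s holomorphic_on ball t0 \<delta>" if "s \<in> cball s0 \<delta>" for s
    unfolding f_def by (intro holomorphic_intros holt that)
  obtain p where p: "\<And>s t. norm (s - s0) < \<delta> / 2 \<Longrightarrow> norm (t - t0) < \<delta> / 2 \<Longrightarrow>
      ((\<lambda>(i, j). p i j * (s - s0) ^ i * (t - t0) ^ j) has_sum f s t) UNIV"
  proof (rule double_power_series[where c = c and f = f and ?s0.0 = s0 and ?t0.0 = t0 and M = M
              and r = "\<delta> / 2" and R = \<delta> and R' = "\<delta> / 2"])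
    show "c j holomorphic_on ball s0 \<delta>" for j
      unfolding c_def using inD in\<Omega> \<delta>
      by (intro holomorphic_intros holomorphic_on_subset[OF v(1)] holomorphic_on_subset[OF v(2)]
          holomorphic_on_compose_gen[OF _ holomorphic_higher_deriv[OF g], unfolded o_def]) auto
    show "norm (c j s) \<le> M / (\<delta> / 2) ^ j" if "s \<in> ball s0 \<delta>" for j s
    proof -
      have "norm ((deriv ^^ j) (f s) t0) \<le> fact j * M / (\<delta> / 2) ^ j"
      proof (rule Cauchy_inequality)
        show "f s holomorphic_on ball t0 (\<delta> / 2)" "continuous_on (cball t0 (\<delta> / 2)) (f s)"
          using \<delta> that by (auto intro!: holomorphic_on_imp_continuous_on intro: holomorphic_on_subset[OF holf])
        show "norm (f s x) \<le> M" if "norm (t0 - x) = \<delta> / 2" for x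
          using that \<open>s \<in> ball s0 \<delta>\<close> \<delta> by (intro M) (auto simp: dist_norm)
      qed (use \<delta> in auto)
      then show ?thesis using that by (simp add: cderiv norm_divide field_simps)
    qed
    show "(\<lambda>j. c j s * (t - t0) ^ j) sums f s t" if "s \<in> ball s0 \<delta>" "t \<in> ball t0 (\<delta> / 2)" for s t
      using holomorphic_power_series[OF holf, of s t] that \<delta> by (simp add: cderiv)
  qed (use \<delta> in auto)
  show thesis by (rule that[of "\<delta> / 2" p]) (use \<delta> p in \<open>auto simp: f_def\<close>)
qed

lemma real_analytic2_on_Re_composition:
  assumes g: "g holomorphic_on \<Omega>" "open \<Omega>" and v: "v holomorphic_on D" "\<kappa> holomorphic_on D" "open D"
    and S: "\<And>s t. (s, t) \<in> S \<Longrightarrow> complex_of_real s \<in> D \<and> complex_of_real t * v (of_real s) \<in> \<Omega>"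
  shows "real_analytic2_on (\<lambda>s t. Re (\<kappa> (of_real s) * g (of_real t * v (of_real s)))) S"
  unfolding real_analytic2_on_def
proof (safe, goal_cases)
  case (1 s0 t0)
  have 2: "complex_of_real s0 \<in> D" "complex_of_real t0 * v (of_real s0) \<in> \<Omega>" using S[OF 1] by auto
  obtain p r where r: "r > 0" and p: "\<And>s t. norm (s - of_real s0) < r \<Longrightarrow> norm (t - of_real t0) < r \<Longrightarrow>
      ((\<lambda>(i, j). p i j * (s - of_real s0) ^ i * (t - of_real t0) ^ j) has_sum \<kappa> s * g (t * v s)) UNIV"
    by (rule double_power_series_composition[OF g v 2]) blast
  show ?case
  proof (intro exI conjI allI impI)
    fix s t assume "\<bar>s - s0\<bar> < r" "\<bar>t - t0\<bar> < r"
    then have "norm (of_real s - complex_of_real s0) < r" "norm (of_real t - complex_of_real t0) < r"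
      by (simp_all flip: of_real_diff)
    from has_sum_Re[OF p[OF this]]
    show "((\<lambda>(i, j). (\<lambda>i j. Re (p i j)) i j * (s - s0) ^ i * (t - t0) ^ j)
        has_sum Re (\<kappa> (of_real s) * g (of_real t * v (of_real s)))) UNIV"
      by (simp add: case_prod_unfold flip: of_real_diff of_real_power)
  qed (fact r)
qed

section \<open>Uniqueness of the continuation\<close>

definition real_analytic_on :: "(real \<Rightarrow> real) \<Rightarrow> real set \<Rightarrow> bool" where
  "real_analytic_on f I \<longleftrightarrow>
     (\<forall>x0\<in>I. \<exists>a r. r > 0 \<and> (\<forall>x. \<bar>x - x0\<bar> < r \<longrightarrow> (\<lambda>n. a n * (x - x0) ^ n) sums f x))"

lemma real_analytic_on_diff:
  assumes "real_analytic_on f I" "real_analytic_on g I"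
  shows "real_analytic_on (\<lambda>x. f x - g x) I"
  unfolding real_analytic_on_def
proof
  fix x0 assume "x0 \<in> I"
  with assms obtain a r b q where r: "r > 0" "\<And>x. \<bar>x - x0\<bar> < r \<Longrightarrow> (\<lambda>n. a n * (x - x0) ^ n) sums f x"
    and q: "q > 0" "\<And>x. \<bar>x - x0\<bar> < q \<Longrightarrow> (\<lambda>n. b n * (x - x0) ^ n) sums g x"
    unfolding real_analytic_on_def by metis
  show "\<exists>a r. r > 0 \<and> (\<forall>x. \<bar>x - x0\<bar> < r \<longrightarrow> (\<lambda>n. a n * (x - x0) ^ n) sums (f x - g x))"
    by (rule exI[of _ "\<lambda>n. a n - b n"], rule exI[of _ "min r q"])
       (use r q in \<open>auto simp: left_diff_distrib intro: sums_diff\<close>)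
qed

text \<open>The same coefficients define a holomorphic function on a complex disc, whose zeros accumulate at \<open>x1\<close>.\<close>

lemma real_power_series_eq_zero:
  fixes a :: "nat \<Rightarrow> real"
  assumes sums: "\<And>x. \<bar>x - x0\<bar> < r \<Longrightarrow> (\<lambda>n. a n * (x - x0) ^ n) sums f x"
    and U: "open U" "x1 \<in> U" "\<bar>x1 - x0\<bar> < r" "\<And>x. x \<in> U \<Longrightarrow> f x = 0"
    and x: "\<bar>x - x0\<bar> < r"
  shows "f x = 0"
proof -
  define F where "F z = (\<Sum>n. complex_of_real (a n) * (z - of_real x0) ^ n)" for z
  have F: "(\<lambda>n. complex_of_real (a n) * (z - of_real x0) ^ n) sums F z" if "z \<in> ball (of_real x0) r" for z
  proof -
    have "norm (z - of_real x0) < r" using that by (simp add: dist_norm norm_minus_commute)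
    then obtain K where K: "norm (z - of_real x0) < K" "K < r" using dense by blast
    have "K > 0" using le_less_trans[OF norm_ge_zero K(1)] .
    have "summable (\<lambda>n. complex_of_real (a n * (x0 + K - x0) ^ n))"
      using sums[of "x0 + K"] K \<open>K > 0\<close> by (intro summable_of_real) (auto simp: sums_iff)
    then have "summable (\<lambda>n. complex_of_real (a n) * of_real K ^ n)" by simp
    then have "summable (\<lambda>n. complex_of_real (a n) * (z - of_real x0) ^ n)"
      by (rule powser_inside) (use K \<open>K > 0\<close> in auto)
    then show ?thesis unfolding F_def by (rule summable_sums)
  qed
  have Ff: "F (of_real y) = of_real (f y)" if "\<bar>y - x0\<bar> < r" for y
  proof -
    have "of_real y \<in> ball (complex_of_real x0) r"
      using that by (simp add: dist_norm abs_minus_commute flip: of_real_diff)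
    from F[OF this] have "(\<lambda>n. complex_of_real (a n * (y - x0) ^ n)) sums F (of_real y)" by simp
    moreover have "(\<lambda>n. complex_of_real (a n * (y - x0) ^ n)) sums of_real (f y)"
      by (intro sums_of_real sums that)
    ultimately show ?thesis by (rule sums_unique2)
  qed
  define V where "V = U \<inter> ball x0 r"
  have V: "open V" "x1 \<in> V" using U by (auto simp: V_def dist_norm abs_minus_commute)
  have lim: "complex_of_real x1 islimpt complex_of_real ` V"
    unfolding islimpt_approachable
  proof (intro allI impI)
    fix e :: real assume "e > 0"
    have "x1 islimpt V" using V interior_limit_point[of x1 V] by (simp add: interior_open)
    then obtain y where "y \<in> V" "y \<noteq> x1" "dist y x1 < e"
      using \<open>e > 0\<close> by (auto simp: islimpt_approachable)
    then show "\<exists>z\<in>complex_of_real ` V. z \<noteq> complex_of_real x1 \<and> dist z (complex_of_real x1) < e"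
      by (intro bexI[of _ "of_real y"]) (auto simp: dist_norm simp flip: of_real_diff)
  qed
  have in_ball: "of_real y \<in> ball (complex_of_real x0) r" if "\<bar>y - x0\<bar> < r" for y
    using that by (simp add: dist_norm abs_minus_commute flip: of_real_diff)
  have "F (of_real x) = 0"
  proof (rule analytic_continuation[OF power_series_holomorphic[OF F] open_ball _ _ _ lim])
    show "complex_of_real ` V \<subseteq> ball (of_real x0) r"
      by (auto simp: V_def dist_norm abs_minus_commute simp flip: of_real_diff)
    show "F z = 0" if "z \<in> complex_of_real ` V" for z
      using that U(4) by (auto simp: V_def Ff dist_norm abs_minus_commute)
  qed (use in_ball U(3) x in auto)
  then show ?thesis using Ff[OF x] by simp
qed

text \<open>Let \<open>Z\<close> be the interior of the zero set. A point of \<open>I - Z\<close> has an interval of convergence that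
  cannot meet \<open>Z\<close>, since otherwise \<open>f\<close> would vanish on all of it; so \<open>I - Z\<close> is open as well, and
  connectedness decides.\<close>

lemma real_analytic_on_eq_zero:
  assumes f: "real_analytic_on f I" and I: "open I" "connected I"
    and U: "open U" "U \<noteq> {}" "U \<subseteq> I" "\<And>x. x \<in> U \<Longrightarrow> f x = 0" and x: "x \<in> I"
  shows "f x = 0"
proof -
  define Z where "Z = interior {x\<in>I. f x = 0}"
  have Z: "open Z" "\<And>x. x \<in> Z \<Longrightarrow> f x = 0" "Z \<subseteq> I"
    using interior_subset[of "{x\<in>I. f x = 0}"] by (auto simp: Z_def)
  have UZ: "U \<subseteq> Z" unfolding Z_def by (rule interior_maximal) (use U in auto)
  have "\<exists>e>0. ball x0 e \<subseteq> I - Z" if x0: "x0 \<in> I - Z" for x0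
  proof -
    obtain a r where r: "r > 0" and a: "\<And>x. \<bar>x - x0\<bar> < r \<Longrightarrow> (\<lambda>n. a n * (x - x0) ^ n) sums f x"
      using f x0 unfolding real_analytic_on_def by blast
    obtain e where e: "e > 0" "ball x0 e \<subseteq> I" using I(1) x0 open_contains_ball by blast
    have "ball x0 (min e r) \<inter> Z = {}"
    proof (rule ccontr)
      assume "ball x0 (min e r) \<inter> Z \<noteq> {}"
      then obtain x1 where x1: "x1 \<in> Z" "\<bar>x1 - x0\<bar> < r"
        by (auto simp: dist_norm abs_minus_commute)
      have "f x = 0" if "\<bar>x - x0\<bar> < r" for x
        using real_power_series_eq_zero[OF a Z(1) x1 Z(2) that] by simp
      then have "ball x0 (min e r) \<subseteq> {x\<in>I. f x = 0}"
        using e by (auto simp: dist_norm abs_minus_commute)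
      then have "ball x0 (min e r) \<subseteq> Z" unfolding Z_def by (rule interior_maximal) auto
      moreover have "x0 \<in> ball x0 (min e r)" using e r by simp
      ultimately show False using x0 by blast
    qed
    then show ?thesis using e r by (intro exI[of _ "min e r"]) auto
  qed
  then have "open (I - Z)" by (simp add: open_contains_ball)
  then have "Z \<inter> I = {} \<or> (I - Z) \<inter> I = {}"
    using connectedD[OF I(2) Z(1)] by blast
  then have "I \<subseteq> Z" using Z(3) UZ U(2,3) by blast
  then show ?thesis using Z x by blast
qed

text \<open>Centring the double series on the line itself kills all terms but those with exponent \<open>0\<close> in the
  fixed variable.\<close>

lemma real_analytic2_on_sections:
  assumes F: "real_analytic2_on F S"
  shows "real_analytic_on (\<lambda>s. F s t) {s. (s, t) \<in> S}" "real_analytic_on (\<lambda>t. F s t) {t. (s, t) \<in> S}"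
proof -
  have ps: "\<exists>p r. r > 0 \<and> (\<forall>s t. \<bar>s - s0\<bar> < r \<longrightarrow> \<bar>t - t0\<bar> < r \<longrightarrow>
       ((\<lambda>(i, j). p i j * (s - s0) ^ i * (t - t0) ^ j) has_sum F s t) UNIV)" if "(s0, t0) \<in> S" for s0 t0
    using bspec[OF F[unfolded real_analytic2_on_def] that] by simp
  show "real_analytic_on (\<lambda>s. F s t) {s. (s, t) \<in> S}"
    unfolding real_analytic_on_def
  proof
    fix s0 assume "s0 \<in> {s. (s, t) \<in> S}"
    then obtain p r where r: "r > 0" and p: "\<And>s t'. \<bar>s - s0\<bar> < r \<Longrightarrow> \<bar>t' - t\<bar> < r \<Longrightarrow>
       ((\<lambda>(i, j). p i j * (s - s0) ^ i * (t' - t) ^ j) has_sum F s t') UNIV"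
      using ps[of s0 t] by blast
    have "(\<lambda>i. p i 0 * (s - s0) ^ i) sums F s t" if "\<bar>s - s0\<bar> < r" for s
    proof -
      have "((\<lambda>(i, j). p i j * (s - s0) ^ i * (t - t) ^ j) has_sum F s t) (range (\<lambda>i. (i, 0)))"
        using p[OF that, of t] r
        by (subst has_sum_cong_neutral[where T = UNIV]) (auto simp: power_0_left)
      then have "((\<lambda>i. p i 0 * (s - s0) ^ i) has_sum F s t) UNIV"
        by (subst (asm) has_sum_reindex) (auto simp: inj_on_def o_def)
      then show ?thesis by (rule has_sum_imp_sums)
    qed
    then show "\<exists>a r. r > 0 \<and> (\<forall>s. \<bar>s - s0\<bar> < r \<longrightarrow> (\<lambda>n. a n * (s - s0) ^ n) sums F s t)"
      using r by (intro exI[of _ "\<lambda>i. p i 0"] exI[of _ r]) simp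
  qed
  show "real_analytic_on (\<lambda>t. F s t) {t. (s, t) \<in> S}"
    unfolding real_analytic_on_def
  proof
    fix t0 assume "t0 \<in> {t. (s, t) \<in> S}"
    then obtain p r where r: "r > 0" and p: "\<And>s' t. \<bar>s' - s\<bar> < r \<Longrightarrow> \<bar>t - t0\<bar> < r \<Longrightarrow>
       ((\<lambda>(i, j). p i j * (s' - s) ^ i * (t - t0) ^ j) has_sum F s' t) UNIV"
      using ps[of s t0] by blast
    have "(\<lambda>j. p 0 j * (t - t0) ^ j) sums F s t" if "\<bar>t - t0\<bar> < r" for t
    proof -
      have "((\<lambda>(i, j). p i j * (s - s) ^ i * (t - t0) ^ j) has_sum F s t) (range (\<lambda>j. (0, j)))"
        using p[OF _ that, of s] r
        by (subst has_sum_cong_neutral[where T = UNIV]) (auto simp: power_0_left)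
      then have "((\<lambda>j. p 0 j * (t - t0) ^ j) has_sum F s t) UNIV"
        by (subst (asm) has_sum_reindex) (auto simp: inj_on_def o_def)
      then show ?thesis by (rule has_sum_imp_sums)
    qed
    then show "\<exists>a r. r > 0 \<and> (\<forall>t. \<bar>t - t0\<bar> < r \<longrightarrow> (\<lambda>n. a n * (t - t0) ^ n) sums F s t)"
      using r by (intro exI[of _ "\<lambda>j. p 0 j"] exI[of _ r]) simp
  qed
qed

text \<open>The identity theorem in one variable suffices, used twice. For \<open>\<bar>t\<bar> < 1\<close> the horizontal line through \<open>t\<close>
  meets the domain of convergence in a whole interval, so both functions agree on the half-strip
  \<open>s < 0\<close>, \<open>\<bar>t\<bar> < 1\<close>; then every vertical line with \<open>s < 0\<close> carries an interval of agreement.\<close>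

lemma horn_H4_continuation_unique:
  assumes F: "is_horn_H4_continuation \<alpha> \<beta> \<gamma> \<delta> F" and G: "is_horn_H4_continuation \<alpha> \<beta> \<gamma> \<delta> G"
    and s: "s < 0"
  shows "F s t = G s t"
proof -
  have dom: "F s t = G s t" if "s < 0" "2 * sqrt \<bar>s\<bar> + \<bar>t\<bar> < 1" for s t
    using F G that by (simp add: is_horn_H4_continuation_def horn_H4_domain_def)
  have an: "real_analytic2_on F ({..<0} \<times> UNIV)" "real_analytic2_on G ({..<0} \<times> UNIV)"
    using F G by (simp_all add: is_horn_H4_continuation_def)
  have strip: "F s t = G s t" if "s < 0" "\<bar>t\<bar> < 1" for s t
  proof -
    have "F s t - G s t = 0"
    proof (rule real_analytic_on_eq_zero[where f = "\<lambda>s. F s t - G s t"])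
      have "{s. (s, t) \<in> {..<0} \<times> UNIV} = {..<0::real}" by auto
      then show "real_analytic_on (\<lambda>s. F s t - G s t) {..<0}"
        using real_analytic_on_diff[OF an[THEN real_analytic2_on_sections(1)], of t] by simp
      \<comment> \<open>\<open>q < x < 0\<close> means \<open>2 * sqrt (- x) + \<bar>t\<bar> < 1\<close>\<close>
      define q where "q = - ((1 - \<bar>t\<bar>) / 2)\<^sup>2"
      show "{q<..<0} \<noteq> {}" "{q<..<0} \<subseteq> {..<0}" using that by (auto simp: q_def)
      fix x assume x: "x \<in> {q<..<0}"
      then have "sqrt \<bar>x\<bar> < sqrt (((1 - \<bar>t\<bar>) / 2)\<^sup>2)"
        by (intro real_sqrt_less_mono) (auto simp: q_def)
      then have "sqrt \<bar>x\<bar> < (1 - \<bar>t\<bar>) / 2" using that by simp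
      then show "F x t - G x t = 0" using x by (simp add: dom)
    qed (use that in auto)
    then show ?thesis by simp
  qed
  have "F s t - G s t = 0"
  proof (rule real_analytic_on_eq_zero[where f = "\<lambda>t. F s t - G s t" and U = "{-1<..<1}" and I = UNIV])
    have "{t. (s, t) \<in> {..<0} \<times> UNIV} = (UNIV::real set)" using s by auto
    then show "real_analytic_on (\<lambda>t. F s t - G s t) UNIV"
      using real_analytic_on_diff[OF an[THEN real_analytic2_on_sections(2)], of s] by simp
  qed (use s strip in auto)
  then show ?thesis by simp
qed

lemma horn_H4_eqI:
  assumes F: "is_horn_H4_continuation \<alpha> \<beta> \<gamma> \<delta> F" and s: "s < 0"
  shows "horn_H4 \<alpha> \<beta> \<gamma> \<delta> s t = F s t"
proof (cases "(s, t) \<in> horn_H4_domain")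
  case True
  then show ?thesis using F s by (auto simp: horn_H4_def is_horn_H4_continuation_def)
next
  case False
  have "(THE v. \<exists>F. is_horn_H4_continuation \<alpha> \<beta> \<gamma> \<delta> F \<and> v = F s t) = F s t"
  proof (rule the_equality)
    show "\<exists>G. is_horn_H4_continuation \<alpha> \<beta> \<gamma> \<delta> G \<and> F s t = G s t" using F by blast
    fix v assume "\<exists>G. is_horn_H4_continuation \<alpha> \<beta> \<gamma> \<delta> G \<and> v = G s t"
    then obtain G where "is_horn_H4_continuation \<alpha> \<beta> \<gamma> \<delta> G" "v = G s t" by blast
    with horn_H4_continuation_unique[OF _ F s] show "v = F s t" by simp
  qed
  with False show ?thesis by (simp add: horn_H4_def)
qed

section \<open>The Horn function \<open>H4\<close> as a real or imaginary part\<close>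

lemma negative_binomial_sums:
  fixes x :: complex
  assumes "norm x < 1"
  shows "(\<lambda>j. of_nat ((n + j) choose n) * x ^ j) sums (1 / (1 - x) ^ Suc n)"
proof -
  have "(\<lambda>j. (-1) ^ j * ((of_nat (Suc n) + of_nat j - 1) gchoose j) * (- x) ^ j)
          sums (1 + - x) powr (- of_nat (Suc n))"
    by (rule one_plus_neg_powr_powser) (use assms in simp)
  moreover have "(-1) ^ j * ((of_nat (Suc n) + of_nat j - 1) gchoose j) * (- x) ^ j
      = of_nat ((n + j) choose n) * x ^ j" for j
  proof -
    have "of_nat (Suc n) + of_nat j - 1 = (of_nat (n + j) :: complex)" by simp
    then have "(of_nat (Suc n) + of_nat j - 1 gchoose j) = (of_nat ((n + j) choose n) :: complex)"
      by (simp only: flip: binomial_gbinomial) (simp add: binomial_symmetric[of j "n + j"])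
    then show ?thesis by (simp add: mult_ac flip: power_mult_distrib)
  qed
  moreover have "(1 + - x) powr (- of_nat (Suc n)) = 1 / (1 - x) ^ Suc n"
  proof -
    have "(1 - x) powr of_nat (Suc n) = (1 - x) ^ Suc n" by (rule powr_nat') simp
    then show ?thesis by (simp only: powr_minus divide_inverse) simp
  qed
  ultimately show ?thesis by (simp only:)
qed

lemma negative_binomial_sums_real:
  fixes x :: real
  assumes "0 \<le> x" "x < 1"
  shows "(\<lambda>j. real ((n + j) choose n) * x ^ j) sums (1 / (1 - x) ^ Suc n)"
proof -
  have "(\<lambda>j. complex_of_real (real ((n + j) choose n) * x ^ j)) sums complex_of_real (1 / (1 - x) ^ Suc n)"
    using negative_binomial_sums[of "of_real x" n] assms by simp
  then show ?thesis by (simp only: sums_of_real_iff)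
qed

lemma norm_of_real_div_one_minus_ii_le:
  "norm (of_real t / (1 - \<i> * complex_of_real u)) \<le> \<bar>t\<bar>"
proof -
  have "1 \<le> norm (1 - \<i> * of_real u)" using abs_Re_le_cmod[of "1 - \<i> * of_real u"] by simp
  then have "\<bar>t\<bar> / norm (1 - \<i> * of_real u) \<le> \<bar>t\<bar> / 1" by (intro divide_left_mono) auto
  then show ?thesis by (simp add: norm_divide)
qed

text \<open>Summed over \<open>j\<close> first, the negative binomial series turns the \<open>n\<close>-th row into
  \<open>A\<^sub>n t ^ n v ^ (n + 1)\<close>; the rows then add up to the hypergeometric series at \<open>t * v\<close>. The
  absolute values are summed in the same way, to the hypergeometric series at \<open>\<bar>t\<bar> / (1 - u)\<close>, and
  this is where \<open>u + \<bar>t\<bar> < 1\<close> enters.\<close>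

lemma horn_H4_double_sum:
  fixes b d :: real and u t :: real
  assumes u: "0 < u" "u + \<bar>t\<bar> < 1"
  defines "v \<equiv> 1 / (1 - \<i> * of_real u)"
  defines "A \<equiv> \<lambda>n. pochhammer b n / pochhammer d n"
  shows "((\<lambda>(n, j). of_real (A n * t ^ n * ((n + j) choose n)) * (\<i> * of_real u) ^ j)
            has_sum (v * hyp2F1 (of_real b) 1 (of_real d) (of_real t * v))) UNIV"
proof -
  let ?T = "\<lambda>(n, j). of_real (A n * t ^ n * ((n + j) choose n)) * (\<i> * of_real u) ^ j :: complex"
  have u1: "u < 1" "\<bar>t\<bar> < 1 - u" using u by linarith+
  have term_norm: "norm (of_real (A n * t ^ n * ((n + j) choose n)) * (\<i> * of_real u) ^ j)
      = \<bar>A n\<bar> * \<bar>t\<bar> ^ n * (real ((n + j) choose n) * u ^ j)" for n j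
    using u by (simp add: norm_mult norm_power abs_mult power_abs)
  have norm_inner: "((\<lambda>j. \<bar>A n\<bar> * \<bar>t\<bar> ^ n * (real ((n + j) choose n) * u ^ j))
      has_sum (\<bar>A n\<bar> * \<bar>t\<bar> ^ n * (1 / (1 - u) ^ Suc n))) UNIV" for n
    using u negative_binomial_sums_real[of u n] by (intro has_sum_cmult_right sums_nonneg_imp_has_sum) auto
  have "norm (complex_of_real (\<bar>t\<bar> / (1 - u))) < 1"
    unfolding norm_of_real using u1 by simp
  from summable_mult[OF hyp2F1_one_abs_summable[OF this, of "of_real b" "of_real d"], of "1 / (1 - u)"]
  have "summable (\<lambda>n. \<bar>A n\<bar> * \<bar>t\<bar> ^ n * (1 / (1 - u) ^ Suc n))"
    using u1 by (simp only: A_def pochhammer_of_real norm_mult norm_divide norm_power norm_of_real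
      abs_divide abs_idempotent power_divide) (simp add: mult_ac)
  then have "(\<lambda>n. \<bar>A n\<bar> * \<bar>t\<bar> ^ n * (1 / (1 - u) ^ Suc n)) summable_on UNIV"
    using u1 by (intro norm_summable_imp_summable_on) simp
  then have "(\<lambda>(n, j). \<bar>A n\<bar> * \<bar>t\<bar> ^ n * (real ((n + j) choose n) * u ^ j)) summable_on Sigma UNIV (\<lambda>_. UNIV)"
  proof (rule summable_on_SigmaI[rotated])
    show "((\<lambda>j. case (n, j) of (n, j) \<Rightarrow> \<bar>A n\<bar> * \<bar>t\<bar> ^ n * (real ((n + j) choose n) * u ^ j))
      has_sum (\<bar>A n\<bar> * \<bar>t\<bar> ^ n * (1 / (1 - u) ^ Suc n))) UNIV" for n
      using norm_inner by simp
  qed (use u in auto)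
  then have summ: "?T summable_on Sigma UNIV (\<lambda>_. UNIV)"
    by (rule Infinite_Sum.abs_summable_summable[OF Infinite_Sum.abs_summable_on_comparison_test'])
       (simp only: case_prod_unfold term_norm order_refl)
  have inner: "((\<lambda>j. of_real (A n * t ^ n * ((n + j) choose n)) * (\<i> * of_real u) ^ j)
      has_sum (of_real (A n * t ^ n) * v ^ Suc n)) UNIV" for n
  proof (rule norm_summable_imp_has_sum)
    show "summable (\<lambda>j. norm (of_real (A n * t ^ n * ((n + j) choose n)) * (\<i> * of_real u) ^ j :: complex))"
      unfolding term_norm using has_sum_imp_sums[OF norm_inner] by (auto simp: sums_iff)
    have "(\<lambda>j. of_real (A n * t ^ n) * (of_nat ((n + j) choose n) * (\<i> * of_real u) ^ j))
        sums (of_real (A n * t ^ n) * (1 / (1 - \<i> * of_real u) ^ Suc n))"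
      using u u1 by (intro sums_mult negative_binomial_sums) (simp add: norm_mult)
    then show "(\<lambda>j. of_real (A n * t ^ n * ((n + j) choose n)) * (\<i> * of_real u) ^ j)
        sums (of_real (A n * t ^ n) * v ^ Suc n)"
      by (simp add: v_def power_divide mult_ac)
  qed
  have tv: "norm (of_real t * v) < 1"
    using norm_of_real_div_one_minus_ii_le[of t u] u by (simp add: v_def)
  have "((\<lambda>n. pochhammer (of_real b) n / pochhammer (of_real d) n * (of_real t * v) ^ n)
      has_sum hyp2F1 (of_real b) 1 (of_real d) (of_real t * v)) UNIV"
    by (intro norm_summable_imp_has_sum hyp2F1_one_sums hyp2F1_one_abs_summable tv)
  from has_sum_cmult_right[OF this, of v]
  have "((\<lambda>n. of_real (A n * t ^ n) * v ^ Suc n)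
      has_sum (v * hyp2F1 (of_real b) 1 (of_real d) (of_real t * v))) UNIV"
    by (simp add: A_def pochhammer_of_real power_mult_distrib mult_ac)
  then have "(?T has_sum (v * hyp2F1 (of_real b) 1 (of_real d) (of_real t * v))) (Sigma UNIV (\<lambda>_. UNIV))"
    using inner summ
    by (intro has_sum_SigmaI[where g = "\<lambda>n. of_real (A n * t ^ n) * v ^ Suc n"]) auto
  then show ?thesis by simp
qed

text \<open>The cases \<open>e = 0\<close> and \<open>e = 1\<close> belong to the real and to the imaginary part. By the duplication
  formula \<open>4 ^ k * (1/2 + e)\<^sub>k * k! = (2 k + e)!\<close>, so the coefficient is a binomial coefficient with
  second index of parity \<open>e\<close>.\<close>

lemma horn_H4_term:
  assumes "e < 2" and s: "s = - (u\<^sup>2 / 4)"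
  shows "pochhammer (1 + real e) (2 * k + n) * b / (pochhammer (1 / 2 + real e) k * d) * (s ^ k / fact k) * (t ^ n / fact n)
       = b / d * t ^ n * ((n + (2 * k + e)) choose n) * ((- 1) ^ k * u ^ (2 * k))"
proof -
  have e: "e = 0 \<or> e = 1" using assms by auto
  have 1: "pochhammer (1 + real e) m = fact (m + e)" for m
    using e pochhammer_rec[of "1::real" m] by (auto simp: pochhammer_fact)
  have 0: "(4::real) ^ k = 2 ^ (2 * k)" by (simp add: power_mult)
  have 2: "pochhammer (1 / 2 + real e) k * fact k * 4 ^ k = fact (2 * k + e)"
    using e pochhammer_double[of "1::real" k] 1[of "2 * k"] fact_double[of k, where 'a = real]
    by (auto simp: 0 pochhammer_fact[symmetric] mult_ac)
  have 3: "real ((n + (2 * k + e)) choose n) = fact (2 * k + n + e) / (fact n * fact (2 * k + e))"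
    by (simp add: binomial_fact add_ac)
  have 4: "s ^ k * 4 ^ k = (- 1) ^ k * u ^ (2 * k)"
    by (simp add: s power_mult flip: power_mult_distrib)
  have nz: "pochhammer (1 / 2 + real e) k \<noteq> 0"
    using 2 by (metis fact_nonzero mult_zero_left)
  show ?thesis
    unfolding 1 3 4[symmetric] 2[symmetric] by (simp add: divide_simps)
qed

text \<open>The factor \<open>(- \<i> / u) ^ e\<close> makes the powers of \<open>\<i> * u\<close> whose exponent has the parity of \<open>e\<close> real and
  the others imaginary, so that taking real parts selects the terms of the Horn series.\<close>

lemma Re_ii_power_parity:
  fixes u :: real
  assumes "e < 2" "u \<noteq> 0"
  shows "Re ((- \<i> / of_real u) ^ e * (\<i> * of_real u) ^ (2 * k + e)) = (- 1) ^ k * u ^ (2 * k)"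
    and "j \<notin> range (\<lambda>k. 2 * k + e) \<Longrightarrow> Re ((- \<i> / of_real u) ^ e * (\<i> * of_real u) ^ j) = 0"
proof -
  have e: "e = 0 \<or> e = 1" using assms by auto
  have ev: "(\<i> * complex_of_real u) ^ (2 * k) = of_real ((- 1) ^ k * u ^ (2 * k))" for k
    by (simp add: power_mult power_mult_distrib) (rule power_minus)
  show "Re ((- \<i> / of_real u) ^ e * (\<i> * of_real u) ^ (2 * k + e)) = (- 1) ^ k * u ^ (2 * k)"
    using e assms(2) unfolding power_add ev by (auto simp: field_simps)
  assume j: "j \<notin> range (\<lambda>k. 2 * k + e)"
  show "Re ((- \<i> / of_real u) ^ e * (\<i> * of_real u) ^ j) = 0"
  proof (cases "even j")
    case True
    then obtain k where k: "j = 2 * k" by blast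
    with j e have "e = 1" by auto
    then show ?thesis unfolding k ev by simp
  next
    case False
    then obtain k where k: "j = 2 * k + 1" by (blast elim: oddE)
    with j e have "e = 0" by auto
    then show ?thesis unfolding k power_add ev by simp
  qed
qed

lemma suminf_suminf_eqI:
  fixes f :: "nat \<Rightarrow> nat \<Rightarrow> real"
  assumes "((\<lambda>(k, n). f k n) has_sum S) UNIV"
  shows "(\<Sum>k. \<Sum>n. f k n) = S"
proof -
  have *: "((\<lambda>(k, n). f k n) has_sum S) (Sigma UNIV (\<lambda>_. UNIV))" using assms by simp
  have inner: "(f k has_sum infsum (f k) UNIV) UNIV" for k
    by (intro has_sum_infsum summable_on_SigmaD1[where f = f and A = UNIV and B = "\<lambda>_. UNIV"]
        has_sum_imp_summable[OF *]) auto
  have "((\<lambda>k. infsum (f k) UNIV) has_sum S) UNIV"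
    by (rule has_sum_SigmaD[OF *]) (use inner in auto)
  moreover have "infsum (f k) UNIV = (\<Sum>n. f k n)" for k
    using has_sum_imp_sums[OF inner] by (simp add: sums_iff)
  ultimately have "((\<lambda>k. \<Sum>n. f k n) has_sum S) UNIV" by simp
  from has_sum_imp_sums[OF this] show ?thesis by (simp add: sums_iff)
qed

lemma horn_H4_series_eq:
  assumes e: "e < 2" and u: "0 < u" "u + \<bar>t\<bar> < 1"
  defines "v \<equiv> 1 / (1 - \<i> * complex_of_real u)"
  shows "horn_H4_series (1 + real e) b (1 / 2 + real e) d (- (u\<^sup>2 / 4)) t
       = Re ((- \<i> / of_real u) ^ e * v * hyp2F1 (of_real b) 1 (of_real d) (of_real t * v))"
proof -
  define S where "S = Re ((- \<i> / of_real u) ^ e * v * hyp2F1 (of_real b) 1 (of_real d) (of_real t * v))"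
  define C where "C n j = pochhammer b n / pochhammer d n * t ^ n * ((n + j) choose n)" for n j
  define R where "R j = Re ((- \<i> / of_real u) ^ e * (\<i> * of_real u) ^ j)" for j
  have pull: "Re ((- \<i> / of_real u) ^ e * (of_real (C n j) * (\<i> * of_real u) ^ j)) = C n j * R j" for n j
    unfolding R_def by (subst mult.left_commute) simp
  have "((\<lambda>(n, j). of_real (C n j) * (\<i> * of_real u) ^ j)
            has_sum (v * hyp2F1 (of_real b) 1 (of_real d) (of_real t * v))) UNIV"
    unfolding C_def v_def by (rule horn_H4_double_sum[OF u])
  from has_sum_Re[OF has_sum_cmult_right[OF this, of "(- \<i> / of_real u) ^ e"]]
  have "((\<lambda>(n, j). C n j * R j) has_sum S) UNIV"
    by (simp only: case_prod_unfold pull S_def mult.assoc)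
  then have "((\<lambda>(n, j). C n j * R j) has_sum S) (range (\<lambda>(k, n). (n, 2 * k + e)))"
  proof (subst has_sum_cong_neutral[where T = UNIV])
    fix x :: "nat \<times> nat" assume "x \<in> UNIV - range (\<lambda>(k, n). (n, 2 * k + e))"
    then have "snd x \<notin> range (\<lambda>k. 2 * k + e)" by (cases x) (auto simp: image_iff)
    then have "R (snd x) = 0"
      unfolding R_def using u by (intro Re_ii_power_parity(2)[OF e]) auto
    then show "(case x of (n, j) \<Rightarrow> C n j * R j) = 0" by (simp add: case_prod_unfold)
  qed auto
  then have "((\<lambda>(n, j). C n j * R j) \<circ> (\<lambda>(k, n). (n, 2 * k + e)) has_sum S) UNIV"
    by (rule has_sum_reindex[THEN iffD1, rotated]) (auto simp: inj_def)
  then have "((\<lambda>(k, n). C n (2 * k + e) * R (2 * k + e)) has_sum S) UNIV"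
    by (simp add: o_def case_prod_unfold)
  moreover have "R (2 * k + e) = (- 1) ^ k * u ^ (2 * k)" for k
    unfolding R_def using u by (intro Re_ii_power_parity(1)[OF e]) auto
  ultimately have "((\<lambda>(k, n). C n (2 * k + e) * ((- 1) ^ k * u ^ (2 * k))) has_sum S) UNIV"
    by simp
  then show ?thesis
    unfolding horn_H4_series_def horn_H4_term[OF e refl] C_def S_def by (rule suminf_suminf_eqI)
qed

text \<open>The closed form found in the domain of convergence makes sense for all \<open>s < 0\<close> once the series is
  replaced by its continuation \<open>g\<close>: the imaginary part of \<open>t * v\<close> is \<open>t * u / (1 + u\<^sup>2)\<close>, which
  vanishes only for \<open>t = 0\<close>, so \<open>t * v\<close> stays in the domain of \<open>g\<close>. Being analytic there, the
  closed form is the continuation of the Horn series.\<close>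

lemma horn_H4_eq:
  fixes b d s t :: real
  assumes d: "d \<notin> \<int>\<^sub>\<le>\<^sub>0"
    and g: "g holomorphic_on (ball 0 1 \<union> {w. Im w \<noteq> 0})"
       "\<And>w. norm w < 1 \<Longrightarrow> g w = hyp2F1 (of_real b) 1 (of_real d) w"
    and e: "e < 2" and u: "u > 0" "s = - (u\<^sup>2 / 4)"
  defines "v \<equiv> 1 / (1 - \<i> * complex_of_real u)"
  shows "horn_H4 (1 + real e) b (1 / 2 + real e) d s t
       = Re ((- \<i> / of_real u) ^ e * v * g (of_real t * v))"
proof -
  \<comment> \<open>the dependence of \<open>u = 2 * sqrt (- s)\<close> and \<open>v\<close> on \<open>s\<close>, extended to the complex half-plane \<open>Re s < 0\<close>\<close>
  define U where "U s = 2 * csqrt (- s)" for s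
  define V where "V s = 1 / (1 - \<i> * U s)" for s
  define K where "K s = (- \<i> / U s) ^ e * V s" for s
  define F where "F = (\<lambda>s t. Re (K (of_real s) * g (of_real t * V (of_real s))))"
  let ?D = "{s. Re s < 0}"
  have U: "U holomorphic_on ?D"
    unfolding U_def by (intro holomorphic_intros) (auto simp: complex_nonpos_Reals_iff)
  have U0: "U s \<noteq> 0" "1 - \<i> * U s \<noteq> 0" if "Re s < 0" for s
  proof -
    show "U s \<noteq> 0" using that by (auto simp: U_def)
    show "1 - \<i> * U s \<noteq> 0"
    proof
      assume "1 - \<i> * U s = 0"
      then have "(\<i> * U s)\<^sup>2 = 1" by simp
      then have "4 * s = 1" by (simp add: U_def power_mult_distrib)
      then have "Re (4 * s) = 1" by simp
      with that show False by simp
    qed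
  qed
  have V: "V holomorphic_on ?D" unfolding V_def by (intro holomorphic_intros U) (use U0 in auto)
  have K: "K holomorphic_on ?D" unfolding K_def by (intro holomorphic_intros U V) (use U0 in auto)
  have U_real: "U (of_real (- (u\<^sup>2 / 4))) = of_real u" if "u > 0" for u
  proof -
    have "csqrt (- of_real (- (u\<^sup>2 / 4))) = of_real (u / 2)"
      by (rule csqrt_unique) (use that in \<open>auto simp: power_divide\<close>)
    then show ?thesis by (simp add: U_def mult.commute)
  qed
  have s_real: "s = - ((2 * sqrt (- s))\<^sup>2 / 4)" "2 * sqrt (- s) > 0" if "s < 0" for s :: real
    using that by (auto simp: power_mult_distrib)
  have "is_horn_H4_continuation (1 + real e) b (1 / 2 + real e) d F"
    unfolding is_horn_H4_continuation_def
  proof (intro conjI ballI, goal_cases)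
    case 1
    show ?case unfolding F_def
    proof (rule real_analytic2_on_Re_composition[OF g(1) _ V K])
      show "open (ball 0 1 \<union> {w. Im w \<noteq> 0})"
      proof -
        have "{w. Im w \<noteq> 0} = {w. Im w > 0} \<union> {w. Im w < 0}" by auto
        then show ?thesis by (auto intro!: open_Un open_halfspace_Im_gt open_halfspace_Im_lt)
      qed
      show "open ?D" by (rule open_halfspace_Re_lt)
      fix s t :: real assume "(s, t) \<in> {..<0} \<times> UNIV"
      then have s: "s < 0" by simp
      define u where "u = 2 * sqrt (- s)"
      have "V (of_real s) = 1 / (1 - \<i> * of_real u)"
        using U_real[OF s_real(2)[OF s]] unfolding s_real(1)[OF s, symmetric] by (simp add: V_def u_def)
      then have "Im (V (of_real s)) = u / (1 + u\<^sup>2)"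
        by (simp add: Im_divide power2_eq_square)
      moreover have "u / (1 + u\<^sup>2) > 0" using s_real(2)[OF s] by (simp add: u_def add_pos_nonneg)
      ultimately show "complex_of_real s \<in> ?D \<and> complex_of_real t * V (of_real s) \<in> ball 0 1 \<union> {w. Im w \<noteq> 0}"
        using s by (cases "t = 0") auto
    qed
  next
    case (2 x)
    obtain s t where x: "x = (s, t)" by (cases x)
    show ?case unfolding x
    proof (clarify)
      assume s: "s < 0"
      define u where "u = 2 * sqrt (- s)"
      have u: "u > 0" "s = - (u\<^sup>2 / 4)" using s_real[OF s] by (simp_all add: u_def)
      have ut: "u + \<bar>t\<bar> < 1" using 2 s by (simp add: x horn_H4_domain_def u_def)
      define v where "v = 1 / (1 - \<i> * complex_of_real u)"
      have tv: "norm (of_real t * v) < 1"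
        using norm_of_real_div_one_minus_ii_le[of t u] ut u by (simp add: v_def)
      have "U (of_real s) = of_real u" unfolding u(2) by (rule U_real[OF u(1)])
      then have "F s t = Re ((- \<i> / of_real u) ^ e * v * g (of_real t * v))"
        by (simp add: F_def K_def V_def v_def)
      also have "\<dots> = horn_H4_series (1 + real e) b (1 / 2 + real e) d s t"
        unfolding u(2) using horn_H4_series_eq[OF e u(1) ut] g(2)[OF tv] by (simp add: v_def)
      finally show "F s t = horn_H4_series (1 + real e) b (1 / 2 + real e) d s t" .
    qed
  qed
  moreover have "s < 0" using u by simp
  ultimately have "horn_H4 (1 + real e) b (1 / 2 + real e) d s t = F s t"
    by (rule horn_H4_eqI)
  also have "\<dots> = Re ((- \<i> / of_real u) ^ e * v * g (of_real t * v))"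
    unfolding u(2) by (simp add: F_def K_def V_def v_def U_real[OF u(1), simplified])
  finally show ?thesis .
qed

lemma hyp2F1_one_cnj:
  fixes a c :: real
  assumes c: "c \<notin> \<int>\<^sub>\<le>\<^sub>0" and z: "norm z < 1 \<or> norm z = 1 \<and> c - a - 1 > 0"
  shows "hyp2F1 (of_real a) 1 (of_real c) (cnj z) = cnj (hyp2F1 (of_real a) 1 (of_real c) z)"
proof -
  have "summable (\<lambda>n. norm (pochhammer (of_real a) n / pochhammer (of_real c) n * z ^ n))"
  proof (cases "norm z < 1")
    case False
    then show ?thesis using z pochhammer_quotient_abs_summable[OF c, of a]
      by (simp add: pochhammer_of_real norm_divide norm_mult norm_power)
  qed (rule hyp2F1_one_abs_summable)
  then have "(\<lambda>n. pochhammer (of_real a) n / pochhammer (of_real c) n * z ^ n)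
      sums hyp2F1 (of_real a) 1 (of_real c) z"
    unfolding hyp2F1_one_altdef by (rule summable_sums[OF summable_norm_cancel])
  then have "(\<lambda>n. cnj (pochhammer (of_real a) n / pochhammer (of_real c) n * z ^ n))
      sums cnj (hyp2F1 (of_real a) 1 (of_real c) z)"
    by (simp only: sums_cnj)
  then show ?thesis
    by (simp add: hyp2F1_one_altdef pochhammer_of_real sums_iff)
qed

theorem mainTheorem7:
  fixes a c x y :: real and z :: complex
  assumes "c \<notin> \<int>\<^sub>\<le>\<^sub>0"
    and "z = Complex x y" and "x \<noteq> 0" and "y \<noteq> 0"
    and "cmod z < 1 \<or> (cmod z = 1 \<and> c - a - 1 > 0)"
  shows "Re (hyp2F1 (of_real a) 1 (of_real c) z) =
           1 + a / c * ((cmod z)\<^sup>2 / x) *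
             horn_H4 1 (a + 1) (1 / 2) (c + 1) (- (y\<^sup>2 / (4 * x\<^sup>2))) ((cmod z)\<^sup>2 / x)
       \<and> Im (hyp2F1 (of_real a) 1 (of_real c) z) =
           a / c * (y * (cmod z)\<^sup>2 / x\<^sup>2) *
             horn_H4 2 (a + 1) (3 / 2) (c + 1) (- (y\<^sup>2 / (4 * x\<^sup>2))) ((cmod z)\<^sup>2 / x)"
proof -
  note c = assms(1) and z = assms(2) and xy = assms(3,4) and dom = assms(5)
  have c1: "c + 1 \<notin> \<int>\<^sub>\<le>\<^sub>0" using c plus_one_in_nonpos_Ints_imp by blast
  then have "complex_of_real (c + 1) \<notin> \<int>\<^sub>\<le>\<^sub>0" by (simp only: of_real_in_nonpos_Ints_iff not_False_eq_True)
  then obtain g where g: "g holomorphic_on (ball 0 1 \<union> {w. Im w \<noteq> 0})"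
    "\<And>w. norm w < 1 \<Longrightarrow> g w = hyp2F1 (of_real (a + 1)) 1 (of_real (c + 1)) w"
    using hyp2F1_one_continuation by metis
  \<comment> \<open>the Horn functions depend on \<open>y\<close> only through \<open>y\<^sup>2\<close>; for \<open>y / x < 0\<close> the formulas arise from \<open>cnj z\<close>\<close>
  define \<sigma> where "\<sigma> = sgn (y / x)"
  define u where "u = \<bar>y / x\<bar>"
  define t where "t = (cmod z)\<^sup>2 / x"
  define v where "v = 1 / (1 - \<i> * complex_of_real u)"
  define z' where "z' = Complex x (\<sigma> * y)"
  have \<sigma>: "\<sigma> = 1 \<or> \<sigma> = - 1" "y / x = \<sigma> * u" unfolding \<sigma>_def u_def sgn_mult_abs
    using xy by (auto simp: sgn_if)
  have u: "u > 0" "- (y\<^sup>2 / (4 * x\<^sup>2)) = - (u\<^sup>2 / 4)" using xy by (auto simp: u_def power_divide)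
  have z'_alt: "z' = (if \<sigma> = 1 then z else cnj z)" using \<sigma> by (auto simp: z'_def z complex_eq_iff)
  then have nz': "norm z' = norm z" "Im z' \<noteq> 0" using xy by (auto simp: z)
  have tv: "of_real t * v = z'"
  proof -
    have "u * x = \<sigma> * y" using \<sigma> xy by (auto simp: field_simps)
    then have 1: "cnj z' = of_real x * (1 - \<i> * of_real u)"
      by (simp add: z'_def complex_eq_iff mult.commute)
    have "of_real ((cmod z)\<^sup>2) = z' * cnj z'" by (simp only: complex_norm_square flip: nz')
    then have "complex_of_real t = z' * (1 - \<i> * of_real u)"
      using xy by (simp add: t_def 1)
    moreover have "1 - \<i> * complex_of_real u \<noteq> 0" by (simp add: complex_eq_iff)
    ultimately show ?thesis by (simp add: v_def)
  qed
  define G where "G = hyp2F1 (of_real a) 1 (of_real c) z"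
  have G: "(if \<sigma> = 1 then G else cnj G) = 1 + of_real (a / c) * (z' * g z')"
  proof -
    have "hyp2F1 (of_real a) 1 (of_real c) z' = 1 + of_real (a / c) * (z' * g z')"
      by (rule hyp2F1_one_eq_continuation[OF c g(1) _ nz'(2)]) (use g(2) nz'(1) dom in auto)
    moreover have "hyp2F1 (of_real a) 1 (of_real c) z' = (if \<sigma> = 1 then G else cnj G)"
      using hyp2F1_one_cnj[OF c dom] by (simp add: z'_alt G_def)
    ultimately show ?thesis by simp
  qed
  define W where "W = v * g (of_real t * v)"
  define H1 where "H1 = horn_H4 1 (a + 1) (1 / 2) (c + 1) (- (y\<^sup>2 / (4 * x\<^sup>2))) t"
  define H2 where "H2 = horn_H4 2 (a + 1) (3 / 2) (c + 1) (- (y\<^sup>2 / (4 * x\<^sup>2))) t"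
  have H1: "H1 = Re W"
    using horn_H4_eq[OF c1 g, of 0 u _ t] u(1) by (simp add: v_def u(2) W_def H1_def)
  have H2: "H2 = Im W / u"
  proof -
    have "H2 = Re ((- \<i> / of_real u) * W)"
      using horn_H4_eq[OF c1 g, of 1 u _ t] u(1) by (simp add: v_def u(2) W_def H2_def)
    also have "\<dots> = Im W / u" by (simp add: Re_divide power2_eq_square)
    finally show ?thesis .
  qed
  have "z' * g z' = of_real t * W" unfolding tv[symmetric] W_def by simp
  with G have GW: "(if \<sigma> = 1 then G else cnj G) = 1 + of_real (a / c * t) * W" by simp
  have "Re G = Re (if \<sigma> = 1 then G else cnj G)" by simp
  also have "\<dots> = 1 + a / c * t * H1" unfolding GW H1 by simp
  finally have Re: "Re G = 1 + a / c * t * H1" .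
  have "Im G = \<sigma> * Im (if \<sigma> = 1 then G else cnj G)" using \<sigma> by auto
  also have "\<dots> = a / c * (\<sigma> * u * t) * H2" unfolding GW H2 using u(1) by simp
  also have "\<sigma> * u * t = y * (cmod z)\<^sup>2 / x\<^sup>2"
    unfolding \<sigma>(2)[symmetric] t_def by (simp add: power2_eq_square)
  finally show ?thesis using Re by (simp add: G_def t_def H1_def H2_def)
qed

end
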